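(* Suppose the random variables $\{X_n \mid n\in\mathbb{N}\}$ form a $\{0,1\}$-valued stochastic process satisfying the following conditions: 1. For any finite increasing sequences of natural numbers $I=(i_1,\dots,i_m)$ and $J=(j_1,\dots,j_r)$ with no common terms, there is a constant $c_I>0$ depending only on $I$ such that for any two $\{0,1\}$-valued sequences $(a_1,\dots,a_m)$ and $(b_1,\dots,b_r)$, $$\mathbb{P}\big((X_{i_1},\dots,X_{i_m})=(a_1,\dots,a_m)\mid X_{j_1}=b_1,\dots,X_{j_r}=b_r\big)>c_I\quad\text{a.s. } X_J.$$ 2. For $n\in\mathbb{N}$ and $B\subseteq\mathbb{N}$ arbitrary, let $\mathcal{F}_{B,-n}=\sigma(X_B,X_n,X_{n+1},\dots)$. For any $B\subseteq \mathbb{N}$, any $m\in\mathbb{N}$ and $\mathbb{P}$-a.e. value $x_B$ of $X_B$, there is a function $g_{m,B,x_B}(n)$ satisfying - $\lim_{n\to\infty}g_{m,B,x_B}(n)=0$, and - for any $n \in \mathbb{N}$ and any $A\in\mathcal{F}_{B,-n}$, $\ \mathrm{Var}\big(\mathbb{P}(A\mid X_1,\dots,X_m,X_B)\mid X_B=x_B\big)<g_{m,B,x_B}(n).$ Then $\{X_n\mid n\in\mathbb{N}\}$ satisfies the infinite intersection property (IIP) and the decorrelation property (DCP), and hence (P5* ).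
   Context: For $A\subseteq\mathbb{N}$, $X_A=(X_a)_{a\in A}$. The quantity $\mathbb{P}(A\mid X_1,\dots,X_m,X_B)$ is a random variable depending on $X_1,\dots,X_m,X_B$, and $\mathrm{Var}(\cdot\mid X_B=x_B)$ is its conditional variance. Conditional independence: for $A,B,C\subseteq\mathbb{N}$, $X_A\perp\!\!\!\perp X_B\mid X_C$ (also written $A\perp\!\!\!\perp_X B\mid C$) means $\mathbb{P}(E_1\mid\sigma(X_C))\mathbb{P}(E_2\mid\sigma(X_C))=\mathbb{P}(E_1\cap E_2\mid\sigma(X_C))$ a.s. for all $E_1\in\sigma(X_A)$, $E_2\in\sigma(X_B)$. (IIP): for any (possibly infinite) $D\subseteq\mathbb{N}$ and any finite pairwise disjoint $A,B,C\subseteq\mathbb{N}\setminus D$, if $X_A\perp\!\!\!\perp X_B\mid (X_C,X_D)$ and $X_A\perp\!\!\!\perp X_C\mid (X_B,X_D)$, then $X_A\perp\!\!\!\perp(X_B,X_C)\mid X_D$. (DCP): for any (possibly infinite) $D\subseteq\mathbb{N}$ and any event $E\in\bigcap_n\sigma(X_D,X_n,X_{n+1},X_{n+2},\dots)$ there exists $E'\in\sigma(X_D)$ with $\mathbb{P}(E\,\Delta\,E')=0$. (P5* ): for all (possibly infinite) $X,Y,Z\subseteq\mathbb{N}$ and any partition $X=\bigcup_kX_k$ into finite subsets, if $X_k\perp\!\!\!\perp_X Y\mid Z\cup\left(\bigcup_{j\ne k}X_j\right)$ for all $k$, then $X\perp\!\!\!\perp_X Y\mid Z$. *)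

theory Defs
  imports "HOL-Probability.Probability"
begin

text \<open>
  The process is indexed by \<^typ>\<open>nat\<close>, so the first variable is \<open>X 0\<close>; the variables
  \<open>X\<^sub>1, \<dots>, X\<^sub>m\<close> of a process indexed from 1 are those with indices in an initial segment
  \<open>{..k}\<close>, where \<open>m = k + 1\<close>.  A family such as \<open>(X\<^sub>B, X\<^sub>n, X\<^sub>n\<^sub>+\<^sub>1, \<dots>)\<close> is the
  subfamily with index set \<open>B \<union> {n..}\<close>.
\<close>

definition path_space :: "nat set \<Rightarrow> (nat \<Rightarrow> nat) measure" where
  "path_space A = PiM A (\<lambda>_. count_space {0, 1})"

definition subfamily :: "(nat \<Rightarrow> 'a \<Rightarrow> nat) \<Rightarrow> nat set \<Rightarrow> 'a \<Rightarrow> nat \<Rightarrow> nat" where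
  "subfamily X A \<omega> = (\<lambda>i\<in>A. X i \<omega>)"

definition sigma_of :: "'a measure \<Rightarrow> (nat \<Rightarrow> 'a \<Rightarrow> nat) \<Rightarrow> nat set \<Rightarrow> 'a measure" where
  "sigma_of M X A = vimage_algebra (space M) (subfamily X A) (path_space A)"

definition cprob :: "'a measure \<Rightarrow> 'a measure \<Rightarrow> 'a set \<Rightarrow> 'a \<Rightarrow> real" where
  "cprob M F E = real_cond_exp M F (indicator E)"

definition cvar :: "'a measure \<Rightarrow> 'a measure \<Rightarrow> ('a \<Rightarrow> real) \<Rightarrow> 'a \<Rightarrow> real" where
  "cvar M F Y = real_cond_exp M F (\<lambda>\<omega>. (Y \<omega> - real_cond_exp M F Y \<omega>)\<^sup>2)"

text \<open>
  \<open>v\<close> is a version of the function \<open>x \<mapsto> Var(Y | X\<^sub>B = x)\<close>, which is determined only up to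
  null sets of the law of \<open>X\<^sub>B\<close>.
\<close>

definition cvar_version ::
    "'a measure \<Rightarrow> (nat \<Rightarrow> 'a \<Rightarrow> nat) \<Rightarrow> nat set \<Rightarrow> ('a \<Rightarrow> real) \<Rightarrow> ((nat \<Rightarrow> nat) \<Rightarrow> real) \<Rightarrow> bool" where
  "cvar_version M X B Y v \<longleftrightarrow>
     v \<in> borel_measurable (path_space B) \<and>
     (AE \<omega> in M. v (subfamily X B \<omega>) = cvar M (sigma_of M X B) Y \<omega>)"

definition cindep ::
    "'a measure \<Rightarrow> (nat \<Rightarrow> 'a \<Rightarrow> nat) \<Rightarrow> nat set \<Rightarrow> nat set \<Rightarrow> nat set \<Rightarrow> bool" where
  "cindep M X A B C \<longleftrightarrow>
     (\<forall>E1 \<in> sets (sigma_of M X A). \<forall>E2 \<in> sets (sigma_of M X B).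
        AE \<omega> in M. cprob M (sigma_of M X C) E1 \<omega> * cprob M (sigma_of M X C) E2 \<omega>
                   = cprob M (sigma_of M X C) (E1 \<inter> E2) \<omega>)"

definition IIP :: "'a measure \<Rightarrow> (nat \<Rightarrow> 'a \<Rightarrow> nat) \<Rightarrow> bool" where
  "IIP M X \<longleftrightarrow>
     (\<forall>D A B C. finite A \<and> finite B \<and> finite C \<and>
        A \<inter> B = {} \<and> A \<inter> C = {} \<and> B \<inter> C = {} \<and> (A \<union> B \<union> C) \<inter> D = {} \<and>
        cindep M X A B (C \<union> D) \<and> cindep M X A C (B \<union> D)
        \<longrightarrow> cindep M X A (B \<union> C) D)"

definition DCP :: "'a measure \<Rightarrow> (nat \<Rightarrow> 'a \<Rightarrow> nat) \<Rightarrow> bool" where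
  "DCP M X \<longleftrightarrow>
     (\<forall>D. \<forall>E \<in> (\<Inter>n. sets (sigma_of M X (D \<union> {n..}))).
        \<exists>E' \<in> sets (sigma_of M X D). measure M ((E - E') \<union> (E' - E)) = 0)"

definition P5star :: "'a measure \<Rightarrow> (nat \<Rightarrow> 'a \<Rightarrow> nat) \<Rightarrow> bool" where
  "P5star M X \<longleftrightarrow>
     (\<forall>U Y Z P. partition_on U P \<and> (\<forall>K\<in>P. finite K) \<and>
        (\<forall>K\<in>P. cindep M X K Y (Z \<union> \<Union>(P - {K})))
        \<longrightarrow> cindep M X U Y Z)"

end

theory Submission
  imports Defs
begin

text \<open>
  The independence of \<open>X\<^sub>A\<close> and \<open>X\<^sub>B\<close> given \<open>X\<^sub>C\<close> says that \<open>P(E | X\<^sub>A, X\<^sub>C)\<close> is almost surely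
  \<open>X\<^sub>C\<close>-measurable for every \<open>E \<in> \<sigma>(X\<^sub>B)\<close>, so (IIP) and (P5*) become statements about intersections of the
  completed algebras \<open>\<sigma>(X\<^sub>S)\<close>, and it suffices to argue with superlevel sets.

  Positivity gives \<open>\<sigma>(X\<^sub>S) \<inter> \<sigma>(X\<^sub>T) = \<sigma>(X\<^bsub>S \<inter> T\<^esub>)\<close> modulo null sets if \<open>S - T\<close> is finite: substitute
  \<open>0\<close> for \<open>X\<^sub>i\<close>, \<open>i \<in> S - T\<close>, in the description of the event by \<open>X\<^sub>S\<close>.  The result agrees with the description by
  \<open>X\<^sub>T\<close> where these \<open>X\<^sub>i\<close> vanish, hence almost surely, because the event that they vanish has
  conditional probability bounded below given \<open>X\<^sub>T\<close>.  This yields (IIP).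

  For \<open>E\<close> as in (DCP) the variance bound holds for all \<open>n\<close>, so the variance is \<open>0\<close> and
  \<open>P(E | X\<^sub>0, \<dots>, X\<^sub>m, X\<^sub>D) = P(E | X\<^sub>D)\<close> for all \<open>m\<close>; hence \<open>P(E | X\<^sub>D)\<close> is the indicator of \<open>E\<close>.
  For (P5*), remove finitely many parts of the partition by the intersection property, and the
  remaining tail by (DCP).
\<close>

section \<open>Integrals and approximation over generated sigma-algebras\<close>

text \<open>Dynkin's argument: equality of the two integrals passes to complements, thanks to
  \<open>space M \<in> G\<close>, and to disjoint countable unions. It lets a conditional
  expectation be recognised on a generating pi-system.\<close>

lemma set_integral_eq_sigma_sets:
  fixes f g :: "'a \<Rightarrow> real"
  assumes f: "integrable M f" and g: "integrable M g"
    and G: "Int_stable G" "G \<subseteq> sets M" "space M \<in> G"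
    and eq: "\<And>A. A \<in> G \<Longrightarrow> (\<integral>x\<in>A. f x \<partial>M) = (\<integral>x\<in>A. g x \<partial>M)"
    and A: "A \<in> sigma_sets (space M) G"
  shows "(\<integral>x\<in>A. f x \<partial>M) = (\<integral>x\<in>A. g x \<partial>M)"
proof -
  have G_Pow: "G \<subseteq> Pow (space M)"
    using G(2) sets.sets_into_space by blast
  have sub: "sigma_sets (space M) G \<subseteq> sets M"
    using G(2) by (rule sets.sigma_sets_subset)
  have int: "set_integrable M B f" "set_integrable M B g" if "B \<in> sets M" for B
    using that f g unfolding set_integrable_def by (intro integrable_mult_indicator; simp)+
  from G(1) G_Pow A show ?thesis
  proof (induction rule: sigma_sets_induct_disjoint)
    case (basic A)
    then show ?case by (rule eq)
  next
    case empty
    show ?case by (simp add: set_lebesgue_integral_def)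
  next
    case (compl A)
    have A: "A \<in> sets M" using compl.hyps sub by blast
    have split: "(\<integral>x\<in>space M. h x \<partial>M) = (\<integral>x\<in>A. h x \<partial>M) + (\<integral>x\<in>space M - A. h x \<partial>M)"
      if "\<And>B. B \<in> sets M \<Longrightarrow> set_integrable M B h" for h :: "'a \<Rightarrow> real"
    proof -
      have "space M = A \<union> (space M - A)" using sets.sets_into_space[OF A] by blast
      then show ?thesis
        using set_integral_Un[of A "space M - A" M h] that A by auto
    qed
    show ?case
      using split[of f] split[of g] int compl.IH eq[OF G(3)] by auto
  next
    case (union A)
    have A: "A i \<in> sets M" for i using union.hyps(2) sub by blast
    have disj: "A i \<inter> A j = {}" if "i \<noteq> j" for i j
      using union.hyps(1) that by (auto simp: disjoint_family_on_def)
    show ?case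
      using lebesgue_integral_countable_add[of A M f, OF A disj] 
        lebesgue_integral_countable_add[of A M g, OF A disj] int A union.IH by simp
  qed
qed

text \<open>The sets approximable in measure by members of an algebra form a sigma-algebra. For a
  countable union, half of the tolerance pays for truncation to finitely many sets and half for
  approximating these.\<close>

lemma (in finite_measure) sigma_sets_approx:
  assumes alg: "algebra (space M) G" and G: "G \<subseteq> sets M"
    and E: "E \<in> sigma_sets (space M) G" and "0 < e"
  shows "\<exists>A\<in>G. measure M ((E - A) \<union> (A - E)) < e"
  using E \<open>0 < e\<close>
proof (induction arbitrary: e)
  interpret algebra "space M" G by fact
  {
    case (Basic a)
    then show ?case by (intro bexI[of _ a]) auto
  next
    case Empty
    then show ?case by (intro bexI[of _ "{}"]) auto
  next
    case (Compl a)
    then obtain A where A: "A \<in> G" "measure M ((a - A) \<union> (A - a)) < e" by blast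
    have "a \<subseteq> space M"
      using Compl.hyps sigma_sets_into_sp[OF space_closed] by blast
    then have "((space M - a) - (space M - A)) \<union> ((space M - A) - (space M - a))
        = (a - A) \<union> (A - a)"
      using sets_into_space[OF A(1)] by blast
    then show ?case using A by (intro bexI[of _ "space M - A"]) auto
  next
    case (Union a)
    have a: "a i \<in> sets M" for i
      using Union.hyps sets.sigma_sets_subset[OF G] by blast
    define B where "B n = (\<Union>i<n. a i)" for n
    have B: "B n \<in> sets M" for n unfolding B_def using a by auto
    have UB: "(\<Union>n. B n) = (\<Union>i. a i)" unfolding B_def by auto
    have "incseq B" unfolding B_def by (force simp: incseq_def)
    then have "(\<lambda>n. measure M (B n)) \<longlonglongrightarrow> measure M (\<Union>i. a i)"
      using finite_Lim_measure_incseq[of B] B UB by auto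
    then obtain N where N: "\<bar>measure M (B N) - measure M (\<Union>i. a i)\<bar> < e / 2"
      using Union.prems by (auto simp: LIMSEQ_iff dest!: spec[of _ "e/2"])
    \<comment> \<open>The denominator has \<open>N + 1\<close> because \<open>N\<close> may be 0;
      the \<open>N\<close> errors still add up to at most \<open>e / 2\<close>.\<close>
    have "\<forall>i. \<exists>A\<in>G. measure M ((a i - A) \<union> (A - a i)) < e / (2 * (real N + 1))"
      using Union.IH Union.prems by simp
    then obtain A where A: "A i \<in> G"
      "measure M ((a i - A i) \<union> (A i - a i)) < e / (2 * (real N + 1))" for i
      by metis
    have AM: "A i \<in> sets M" for i using A G by blast
    let ?A = "\<Union>i<N. A i" and ?a = "\<Union>i. a i"
    have "?A \<in> G" using A by (intro finite_UN) auto
    moreover have "measure M ((?a - ?A) \<union> (?A - ?a)) < e"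
    proof -
      have "measure M ((?a - ?A) \<union> (?A - ?a))
          \<le> measure M ((?a - B N) \<union> (\<Union>i<N. (a i - A i) \<union> (A i - a i)))"
        using a AM B by (intro finite_measure_mono sets.Un sets.Diff sets.finite_UN sets.countable_UN)
          (auto simp: B_def)
      also have "\<dots> \<le> measure M (?a - B N) + measure M (\<Union>i<N. (a i - A i) \<union> (A i - a i))"
        using a AM B by (intro measure_Un_le) auto
      also have "measure M (\<Union>i<N. (a i - A i) \<union> (A i - a i))
          \<le> (\<Sum>i<N. measure M ((a i - A i) \<union> (A i - a i)))"
        using a AM by (intro finite_measure_subadditive_finite) auto
      also have "\<dots> \<le> (\<Sum>i<N. e / (2 * (real N + 1)))"
        using A(2) by (intro sum_mono less_imp_le)
      also have "\<dots> \<le> e / 2"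
        using Union.prems by (simp add: field_simps)
      also have "measure M (?a - B N) = measure M ?a - measure M (B N)"
        using a B by (intro finite_measure_Diff) (auto simp: B_def)
      finally show ?thesis using N by linarith
    qed
    ultimately show ?case by blast
  }
qed

text \<open>A real number is the supremum of the rationals below it, and countably many null sets
  unite to one. Measurability up to null sets is thereby reduced to events.\<close>

lemma borel_measurable_AE_from_superlevel_sets:
  fixes h :: "'a \<Rightarrow> real"
  assumes F: "subalgebra M F"
    and lev: "\<And>q :: rat. \<exists>E\<in>sets F. AE x in M. h x > of_rat q \<longleftrightarrow> x \<in> E"
  shows "\<exists>g\<in>borel_measurable F. AE x in M. h x = g x"
proof -
  obtain E where E: "E q \<in> sets F" "AE x in M. h x > of_rat q \<longleftrightarrow> x \<in> E q" for q :: rat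
    using lev by metis
  \<comment> \<open>Rationals \<open>q\<close> with \<open>x \<notin> E q\<close> contribute the
    least extended real and do not affect the supremum. On the exceptional null set the supremum may
    be infinite, hence the detour through \<open>ereal\<close>.\<close>
  define g where "g x = (SUP q. if x \<in> E q then ereal (of_rat q) else -\<infinity>)" for x
  have [measurable]: "E q \<in> sets F" for q by (rule E)
  have "g \<in> borel_measurable F" unfolding g_def by measurable
  moreover have "AE x in M. \<forall>q. h x > of_rat q \<longleftrightarrow> x \<in> E q"
    using E(2) by (simp add: AE_all_countable)
  then have "AE x in M. h x = real_of_ereal (g x)"
  proof (eventually_elim, goal_cases)
    case (1 x)
    have "g x = ereal (h x)"
    proof (rule antisym)
      show "g x \<le> ereal (h x)"
        unfolding g_def by (rule SUP_least) (use 1 in \<open>auto intro: less_imp_le\<close>)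
      show "ereal (h x) \<le> g x"
      proof (rule dense_le_bounded[of "-\<infinity>"])
        show "- \<infinity> < ereal (h x)" by simp
        fix w assume "- \<infinity> < w" "w < ereal (h x)"
        then obtain r where r: "w = ereal r" "r < h x" by (cases w) auto
        obtain q where q: "r < of_rat q" "of_rat q < h x"
          using of_rat_dense[OF r(2)] by blast
        have "w \<le> (if x \<in> E q then ereal (of_rat q) else -\<infinity>)"
          using q 1 r by auto
        also have "\<dots> \<le> g x" unfolding g_def by (rule SUP_upper) simp
        finally show "w \<le> g x" .
      qed
    qed
    then show ?case by simp
  qed
  ultimately show ?thesis
    by (intro bexI[of _ "\<lambda>x. real_of_ereal (g x)"]) auto
qed


section \<open>Sigma-algebras generated by subfamilies of the process\<close>

locale binary_process = prob_space M for M :: "'a measure" +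
  fixes X :: "nat \<Rightarrow> 'a \<Rightarrow> nat"
  assumes X_measurable [measurable]: "X n \<in> measurable M (count_space {0, 1})"
begin

abbreviation \<F> :: "nat set \<Rightarrow> 'a measure" where
  "\<F> S \<equiv> sigma_of M X S"

lemma space_sigma_of [simp]: "space (\<F> S) = space M"
  by (simp add: sigma_of_def)

lemma X_range: "\<omega> \<in> space M \<Longrightarrow> X n \<omega> \<in> {0, 1}"
  using measurable_space[OF X_measurable] by simp

lemma subfamily_in_path_space: "subfamily X S \<in> space M \<rightarrow> space (path_space S)"
  using X_range by (auto simp: subfamily_def path_space_def space_PiM)

lemma measurable_X: "i \<in> S \<Longrightarrow> X i \<in> measurable (\<F> S) (count_space {0, 1})"
proof -
  assume i: "i \<in> S"
  have "subfamily X S \<in> measurable (\<F> S) (path_space S)"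
    unfolding sigma_of_def by (rule measurable_vimage_algebra1[OF subfamily_in_path_space])
  moreover have "(\<lambda>x. x i) \<in> measurable (path_space S) (count_space {0, 1})"
    unfolding path_space_def using i by (rule measurable_component_singleton)
  ultimately have "(\<lambda>\<omega>. subfamily X S \<omega> i) \<in> measurable (\<F> S) (count_space {0, 1})"
    by (rule measurable_compose)
  then show ?thesis using i by (simp add: subfamily_def)
qed

lemma measurable_subfamily:
  assumes "\<And>i. i \<in> S \<Longrightarrow> X i \<in> measurable N (count_space {0, 1})"
  shows "subfamily X S \<in> measurable N (path_space S)"
  unfolding subfamily_def path_space_def using assms by (rule measurable_restrict)

lemma sets_sigma_of_subset:
  assumes "space N = space M" "\<And>i. i \<in> S \<Longrightarrow> X i \<in> measurable N (count_space {0, 1})"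
  shows "sets (\<F> S) \<subseteq> sets N"
  unfolding sigma_of_def
  using assms(1) measurable_subfamily[OF assms(2)] by (rule sets_image_in_sets)

lemma sigma_of_mono: "S \<subseteq> T \<Longrightarrow> sets (\<F> S) \<subseteq> sets (\<F> T)"
  by (rule sets_sigma_of_subset[OF _ measurable_X]) auto

lemma subalgebra_sigma_of_mono: "S \<subseteq> T \<Longrightarrow> subalgebra (\<F> T) (\<F> S)"
  using sigma_of_mono by (simp add: subalgebra_def)

lemma sets_sigma_of_le: "sets (\<F> S) \<subseteq> sets M"
  by (rule sets_sigma_of_subset[OF refl X_measurable])

lemma subalgebra_sigma_of: "subalgebra M (\<F> S)"
  using sets_sigma_of_le by (simp add: subalgebra_def)

lemma sigma_finite_subalgebra_sigma_of: "sigma_finite_subalgebra M (\<F> S)"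
  by (rule finite_measure_subalgebra_is_sigma_finite)
     (simp add: finite_measure_subalgebra_def finite_measure_subalgebra_axioms_def
        subalgebra_sigma_of finite_measure_axioms)

sublocale cond: sigma_finite_subalgebra M "\<F> S" for S
  by (rule sigma_finite_subalgebra_sigma_of)

lemma sets_sigma_of_iff:
  "E \<in> sets (\<F> S) \<longleftrightarrow> (\<exists>B\<in>sets (path_space S). E = {\<omega> \<in> space M. subfamily X S \<omega> \<in> B})"
  unfolding sigma_of_def sets_vimage_algebra2[OF subfamily_in_path_space] by auto

text \<open>\<open>\<F> S\<close> is the least sigma-algebra that makes each single variable with
  index in \<open>S\<close> measurable, so only these have to be checked. The generating classes
  below are all verified in this way.\<close>

lemma sets_sigma_of_subset_sigma_sets:
  assumes "G \<subseteq> Pow (space M)" "\<And>i. i \<in> S \<Longrightarrow> \<exists>T. i \<in> T \<and> sets (\<F> T) \<subseteq> G"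
  shows "sets (\<F> S) \<subseteq> sigma_sets (space M) G"
proof -
  have "sets (\<F> S) \<subseteq> sets (sigma (space M) G)"
  proof (rule sets_sigma_of_subset)
    fix i assume "i \<in> S"
    then obtain T where T: "i \<in> T" "sets (\<F> T) \<subseteq> G" using assms(2) by blast
    show "X i \<in> measurable (sigma (space M) G) (count_space {0, 1})"
    proof (rule measurableI)
      fix A :: "nat set" assume "A \<in> sets (count_space {0, 1})"
      then have "X i -` A \<inter> space M \<in> sets (\<F> T)"
        using measurable_sets[OF measurable_X[OF T(1)]] by auto
      then show "X i -` A \<inter> space (sigma (space M) G) \<in> sets (sigma (space M) G)"
        using T(2) assms(1) by (auto simp: space_measure_of_conv)
    qed (use X_range in \<open>auto simp: space_measure_of_conv\<close>)
  qed (simp add: space_measure_of_conv)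
  then show ?thesis using assms(1) by simp
qed

section \<open>Lower bounds for conditional probabilities, from cylinders to all events\<close>

text \<open>An event in finitely many binary variables is a finite disjoint union of cylinders, over
  which the bound is summed. Cylinders of probability 0, where \<open>pos\<close> says nothing,
  satisfy it trivially.\<close>

lemma prob_inter_ge_finite:
  assumes J: "finite J" and Q: "{\<omega> \<in> space M. Q \<omega>} \<in> events"
    and pos: "\<And>b. b \<in> J \<rightarrow> {0, 1} \<Longrightarrow> prob {\<omega> \<in> space M. \<forall>j\<in>J. X j \<omega> = b j} > 0 \<Longrightarrow>
       cond_prob M Q (\<lambda>\<omega>. \<forall>j\<in>J. X j \<omega> = b j) > c"
    and E: "E \<in> sets (\<F> J)"
  shows "c * prob E \<le> prob (E \<inter> {\<omega> \<in> space M. Q \<omega>})"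
proof -
  let ?Q = "{\<omega> \<in> space M. Q \<omega>}"
  obtain B where B: "E = {\<omega> \<in> space M. subfamily X J \<omega> \<in> B}"
    using E sets_sigma_of_iff by blast
  \<comment> \<open>Extensional 0-1 functions on \<open>J\<close> are finite in number, and distinct
    ones give disjoint cylinders.\<close>
  define P where "P = B \<inter> (J \<rightarrow>\<^sub>E {0, 1})"
  define W where "W b = {\<omega> \<in> space M. \<forall>j\<in>J. X j \<omega> = b j}" for b
  have W[measurable]: "W b \<in> events" for b
    unfolding W_def using J by measurable
  have finP: "finite P" unfolding P_def using J by (intro finite_Int disjI2 finite_PiE) auto
  have sub: "subfamily X J \<omega> = b" if "\<omega> \<in> W b" "b \<in> P" for \<omega> b
    using that unfolding W_def P_def subfamily_def
    by (intro PiE_ext[of _ J "\<lambda>_. UNIV"]) (auto simp: PiE_iff)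
  have E_eq: "E = (\<Union>b\<in>P. W b)"
  proof (intro equalityI subsetI)
    fix \<omega> assume w: "\<omega> \<in> E"
    then have "subfamily X J \<omega> \<in> P" "\<omega> \<in> W (subfamily X J \<omega>)"
      using X_range unfolding B P_def W_def by (auto simp: subfamily_def)
    then show "\<omega> \<in> (\<Union>b\<in>P. W b)" by blast
  next
    fix \<omega> assume "\<omega> \<in> (\<Union>b\<in>P. W b)"
    then obtain b where b: "b \<in> P" "\<omega> \<in> W b" by blast
    then show "\<omega> \<in> E" using sub[OF b(2,1)] by (auto simp: B P_def W_def)
  qed
  have disj: "disjoint_family_on W P"
    unfolding disjoint_family_on_def using sub by blast
  have ge: "c * prob (W b) \<le> prob (W b \<inter> ?Q)" if b: "b \<in> P" for b
  proof (cases "prob (W b) > 0")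
    case True
    have "b \<in> J \<rightarrow> {0, 1}" using b by (simp add: P_def PiE_def)
    from pos[OF this] True have "c < prob {\<omega> \<in> space M. Q \<omega> \<and> (\<forall>j\<in>J. X j \<omega> = b j)} / prob (W b)"
      by (simp add: W_def cond_prob_def)
    also have "{\<omega> \<in> space M. Q \<omega> \<and> (\<forall>j\<in>J. X j \<omega> = b j)} = W b \<inter> ?Q"
      by (auto simp: W_def)
    finally show ?thesis using True by (simp add: field_simps)
  next
    case False
    then show ?thesis using zero_less_measure_iff[of M "W b"] by simp
  qed
  have "c * prob E = (\<Sum>b\<in>P. c * prob (W b))"
    unfolding E_eq using finP disj W
    by (subst finite_measure_finite_Union) (auto simp: sum_distrib_left)
  also have "\<dots> \<le> (\<Sum>b\<in>P. prob (W b \<inter> ?Q))" by (rule sum_mono) (rule ge)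
  also have "\<dots> = prob (\<Union>b\<in>P. W b \<inter> ?Q)"
    using finP disj W Q
    by (intro finite_measure_finite_Union[symmetric]) (auto simp: disjoint_family_on_def)
  also have "(\<Union>b\<in>P. W b \<inter> ?Q) = E \<inter> ?Q" unfolding E_eq by blast
  finally show ?thesis .
qed

text \<open>Events in finitely many of the variables form an algebra generating
  \<open>\<F> T\<close>, and the bound survives approximation in measure by such events.\<close>

lemma prob_inter_ge:
  assumes Q: "{\<omega> \<in> space M. Q \<omega>} \<in> events" and c: "0 < c"
    and pos: "\<And>J b. finite J \<Longrightarrow> J \<subseteq> T \<Longrightarrow> b \<in> J \<rightarrow> {0, 1} \<Longrightarrow>
       prob {\<omega> \<in> space M. \<forall>j\<in>J. X j \<omega> = b j} > 0 \<Longrightarrow>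
       cond_prob M Q (\<lambda>\<omega>. \<forall>j\<in>J. X j \<omega> = b j) > c"
    and E: "E \<in> sets (\<F> T)"
  shows "c * prob E \<le> prob (E \<inter> {\<omega> \<in> space M. Q \<omega>})"
proof (rule field_le_epsilon)
  let ?Q = "{\<omega> \<in> space M. Q \<omega>}"
  define G where "G = (\<Union>J\<in>{J. finite J \<and> J \<subseteq> T}. sets (\<F> J))"
  have GM: "G \<subseteq> events" unfolding G_def using sets_sigma_of_le by blast
  have "algebra (space M) G"
    unfolding algebra_iff_Un
  proof (intro conjI ballI)
    show "G \<subseteq> Pow (space M)" using GM sets.sets_into_space by blast
    show "{} \<in> G" unfolding G_def by (rule UN_I[of "{}"]) auto
    fix a assume "a \<in> G"
    then obtain J where J: "finite J" "J \<subseteq> T" "a \<in> sets (\<F> J)" unfolding G_def by blast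
    then have "space M - a \<in> sets (\<F> J)" using sets.compl_sets[OF J(3)] by simp
    then show "space M - a \<in> G" unfolding G_def using J by blast
    fix b assume "b \<in> G"
    then obtain K where K: "finite K" "K \<subseteq> T" "b \<in> sets (\<F> K)" unfolding G_def by blast
    have "a \<in> sets (\<F> (J \<union> K))" "b \<in> sets (\<F> (J \<union> K))"
      using J(3) K(3) sigma_of_mono[of J "J \<union> K"] sigma_of_mono[of K "J \<union> K"] by auto
    then have "a \<union> b \<in> sets (\<F> (J \<union> K))" by (rule sets.Un)
    then show "a \<union> b \<in> G" unfolding G_def using J K by blast
  qed
  moreover have "E \<in> sigma_sets (space M) G"
  proof (rule subsetD[OF sets_sigma_of_subset_sigma_sets E])
    show "G \<subseteq> Pow (space M)" using GM sets.sets_into_space by blast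
    show "\<exists>S. i \<in> S \<and> sets (\<F> S) \<subseteq> G" if "i \<in> T" for i
      unfolding G_def using that by (intro exI[of _ "{i}"] conjI UN_upper) simp_all
  qed
  ultimately have approx: "\<exists>A\<in>G. prob ((E - A) \<union> (A - E)) < e" if "e > 0" for e
    using sigma_sets_approx[OF _ GM] that by blast
  fix e :: real assume "0 < e"
  \<comment> \<open>The symmetric difference is paid for with factor \<open>c\<close> in passing
    from \<open>E\<close> to \<open>A\<close>, and with factor 1 in passing back from
    \<open>A \<inter> ?Q\<close> to \<open>E \<inter> ?Q\<close>.\<close>
  then have "0 < e / (1 + c)" using c by simp
  then obtain A where A: "A \<in> G" "prob ((E - A) \<union> (A - E)) < e / (1 + c)"
    using approx by blast
  have [measurable]: "E \<in> events" "A \<in> events" "?Q \<in> events"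
    using E A Q GM sets_sigma_of_le by auto
  let ?D = "(E - A) \<union> (A - E)"
  have "prob E \<le> prob (A \<union> ?D)" by (intro finite_measure_mono) auto
  also have "\<dots> \<le> prob A + prob ?D" by (rule measure_Un_le) auto
  finally have 1: "c * prob E \<le> c * prob A + c * prob ?D"
    using c by (simp flip: distrib_left)
  have "c * prob A \<le> prob (A \<inter> ?Q)"
  proof -
    obtain J where J: "finite J" "J \<subseteq> T" "A \<in> sets (\<F> J)"
      using A(1) unfolding G_def by blast
    show ?thesis by (rule prob_inter_ge_finite[OF J(1) Q pos[OF J(1,2)] J(3)])
  qed
  also have "\<dots> \<le> prob ((E \<inter> ?Q) \<union> ?D)" by (intro finite_measure_mono) auto
  also have "\<dots> \<le> prob (E \<inter> ?Q) + prob ?D" by (rule measure_Un_le) auto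
  finally have "c * prob E \<le> prob (E \<inter> ?Q) + (1 + c) * prob ?D"
    using 1 by (simp add: algebra_simps)
  also have "(1 + c) * prob ?D \<le> e"
    using A(2) c by (simp add: field_simps)
  finally show "c * prob E \<le> prob (E \<inter> ?Q) + e" by simp
qed

section \<open>Events up to null sets and conditional probabilities\<close>

text \<open>For subsets of \<open>space M\<close> this is membership in the completion of
  \<open>\<F> S\<close> by the null sets of \<open>M\<close>.\<close>

definition ess_measurable :: "nat set \<Rightarrow> 'a set \<Rightarrow> bool" where
  "ess_measurable S E \<longleftrightarrow> (\<exists>E'\<in>sets (\<F> S). AE \<omega> in M. \<omega> \<in> E \<longleftrightarrow> \<omega> \<in> E')"

lemma ess_measurable_mono: "ess_measurable S E \<Longrightarrow> S \<subseteq> T \<Longrightarrow> ess_measurable T E"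
  unfolding ess_measurable_def using sigma_of_mono by blast

lemma integrable_indicator_event [simp]: "E \<in> events \<Longrightarrow> integrable M (indicator E :: 'a \<Rightarrow> real)"
  by (simp add: emeasure_eq_measure)

lemma integrable_cprob [simp]: "E \<in> events \<Longrightarrow> integrable M (cprob M (\<F> S) E)"
  unfolding cprob_def by (rule cond.real_cond_exp_int) simp

lemma cprob_measurable [measurable]: "cprob M (\<F> S) E \<in> borel_measurable (\<F> S)"
  unfolding cprob_def by simp

lemma cprob_measurable2 [measurable]: "cprob M (\<F> S) E \<in> borel_measurable M"
  unfolding cprob_def by simp

lemma AE_cprob_bounds:
  assumes [measurable]: "E \<in> events"
  shows "AE \<omega> in M. 0 \<le> cprob M (\<F> S) E \<omega> \<and> cprob M (\<F> S) E \<omega> \<le> 1"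
proof -
  have "AE \<omega> in M. 0 \<le> cprob M (\<F> S) E \<omega>" unfolding cprob_def
    by (rule cond.real_cond_exp_ge_c) auto
  moreover have "AE \<omega> in M. cprob M (\<F> S) E \<omega> \<le> 1" unfolding cprob_def
    by (rule cond.real_cond_exp_le_c) (auto simp: indicator_def)
  ultimately show ?thesis by eventually_elim simp
qed

section \<open>Conditional independence as measurability of conditional probabilities\<close>

lemma cindep_sym:
  assumes "cindep M X A B C"
  shows "cindep M X B A C"
  unfolding cindep_def
proof (intro ballI)
  fix E1 E2 assume "E1 \<in> sets (\<F> B)" "E2 \<in> sets (\<F> A)"
  then have "AE \<omega> in M. cprob M (\<F> C) E2 \<omega> * cprob M (\<F> C) E1 \<omega> = cprob M (\<F> C) (E2 \<inter> E1) \<omega>"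
    using assms unfolding cindep_def by blast
  then show "AE \<omega> in M. cprob M (\<F> C) E1 \<omega> * cprob M (\<F> C) E2 \<omega> = cprob M (\<F> C) (E1 \<inter> E2) \<omega>"
    by (simp only: mult.commute Int_commute)
qed

text \<open>Intersections of an event of the \<open>A\<close>-variables with one of the
  \<open>C\<close>-variables form a pi-system generating \<open>\<F> (A \<union> C)\<close>. Over
  these sets the product formula gives the indicator of \<open>E\<close> and the candidate
  \<open>?h\<close> the same integral.\<close>

lemma cindep_cprob_eq:
  assumes ind: "cindep M X A B C" and E: "E \<in> sets (\<F> B)"
  shows "AE \<omega> in M. cprob M (\<F> (A \<union> C)) E \<omega> = cprob M (\<F> C) E \<omega>"
proof -
  have EM [measurable]: "E \<in> events" using E sets_sigma_of_le by blast
  let ?h = "cprob M (\<F> C) E"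
  define G where "G = {E1 \<inter> E3 | E1 E3. E1 \<in> sets (\<F> A) \<and> E3 \<in> sets (\<F> C)}"
  have G1: "Int_stable G"
  proof (rule Int_stableI)
    fix a b assume "a \<in> G" "b \<in> G"
    then obtain a1 a3 b1 b3 where "a = a1 \<inter> a3" "b = b1 \<inter> b3" "a1 \<in> sets (\<F> A)"
      "b1 \<in> sets (\<F> A)" "a3 \<in> sets (\<F> C)" "b3 \<in> sets (\<F> C)" unfolding G_def by blast
    moreover from this have "a \<inter> b = (a1 \<inter> b1) \<inter> (a3 \<inter> b3)" by blast
    ultimately show "a \<inter> b \<in> G" unfolding G_def by blast
  qed
  have AG: "sets (\<F> A) \<subseteq> G"
  proof
    fix a assume a: "a \<in> sets (\<F> A)"
    then have "a = a \<inter> space M" using sets.sets_into_space[OF a] by auto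
    moreover have "space M \<in> sets (\<F> C)" using sets.top[of "\<F> C"] by simp
    ultimately show "a \<in> G" unfolding G_def using a by blast
  qed
  have CG: "sets (\<F> C) \<subseteq> G"
  proof
    fix a assume a: "a \<in> sets (\<F> C)"
    then have "a = space M \<inter> a" using sets.sets_into_space[OF a] by auto
    moreover have "space M \<in> sets (\<F> A)" using sets.top[of "\<F> A"] by simp
    ultimately show "a \<in> G" unfolding G_def using a by blast
  qed
  have GM: "G \<subseteq> events"
  proof
    fix a assume "a \<in> G"
    then obtain E1 E3 where "a = E1 \<inter> E3" "E1 \<in> events" "E3 \<in> events"
      unfolding G_def using sets_sigma_of_le by blast
    then show "a \<in> events" by simp
  qed
  have top: "space M \<in> G" using AG sets.top[of "\<F> A"] by auto
  have gen: "sets (\<F> (A \<union> C)) \<subseteq> sigma_sets (space M) G"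
  proof (rule sets_sigma_of_subset_sigma_sets)
    show "G \<subseteq> Pow (space M)" using GM sets.sets_into_space by blast
    show "\<exists>T. i \<in> T \<and> sets (\<F> T) \<subseteq> G" if "i \<in> A \<union> C" for i
      using that AG CG by blast
  qed
  have eq: "(\<integral>\<omega>\<in>K. indicator E \<omega> \<partial>M) = (\<integral>\<omega>\<in>K. ?h \<omega> \<partial>M)" if KG: "K \<in> G" for K
  proof -
    obtain E1 E3 where K: "K = E1 \<inter> E3" and E1: "E1 \<in> sets (\<F> A)" and E3: "E3 \<in> sets (\<F> C)"
      using KG unfolding G_def by blast
    have [measurable]: "E1 \<in> events" "E3 \<in> events"
      using subsetD[OF sets_sigma_of_le E1] subsetD[OF sets_sigma_of_le E3] .
    note E3 [measurable]
    \<comment> \<open>The product of \<open>?h\<close> with the indicator of \<open>E3\<close> is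
      measurable for \<open>\<F> C\<close>. So the indicator of \<open>E1\<close> may be exchanged
      for its conditional probability, the product formula applied, and the conditioning undone on
      \<open>E1 \<inter> E\<close>.\<close>
    have "(\<integral>\<omega>\<in>K. ?h \<omega> \<partial>M) = (\<integral>\<omega>. (indicator E3 \<omega> * ?h \<omega>) * indicator E1 \<omega> \<partial>M)"
      unfolding set_lebesgue_integral_def K
      by (intro Bochner_Integration.integral_cong) (auto simp: indicator_def)
    also have "\<dots> = (\<integral>\<omega>. (indicator E3 \<omega> * ?h \<omega>) * cprob M (\<F> C) E1 \<omega> \<partial>M)"
      unfolding cprob_def[of M "\<F> C" E1]
    proof (rule cond.real_cond_exp_intg(2)[symmetric])
      have "integrable M (\<lambda>\<omega>. indicator (E3 \<inter> E1) \<omega> *\<^sub>R ?h \<omega>)"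
        by (rule integrable_mult_indicator) auto
      then show "integrable M (\<lambda>\<omega>. (indicator E3 \<omega> * ?h \<omega>) * indicator E1 \<omega>)"
        by (simp add: indicator_inter_arith ac_simps)
    qed auto
    also have "\<dots> = (\<integral>\<omega>. indicator E3 \<omega> * cprob M (\<F> C) (E1 \<inter> E) \<omega> \<partial>M)"
    proof (rule integral_cong_AE)
      have "AE \<omega> in M. cprob M (\<F> C) E1 \<omega> * ?h \<omega> = cprob M (\<F> C) (E1 \<inter> E) \<omega>"
        using ind E1 E unfolding cindep_def by blast
      then show "AE \<omega> in M. indicator E3 \<omega> * ?h \<omega> * cprob M (\<F> C) E1 \<omega>
          = indicator E3 \<omega> * cprob M (\<F> C) (E1 \<inter> E) \<omega>"
        by eventually_elim (simp add: ac_simps)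
    qed measurable
    also have "\<dots> = (\<integral>\<omega>. indicator E3 \<omega> * indicator (E1 \<inter> E) \<omega> \<partial>M)"
      unfolding cprob_def
    proof (rule cond.real_cond_exp_intg(2))
      have "integrable M (\<lambda>\<omega>. indicator (E3 \<inter> (E1 \<inter> E)) \<omega> :: real)" by simp
      then show "integrable M (\<lambda>\<omega>. indicator E3 \<omega> * indicator (E1 \<inter> E) \<omega> :: real)"
        by (simp add: indicator_inter_arith)
    qed auto
    also have "\<dots> = (\<integral>\<omega>\<in>K. indicator E \<omega> \<partial>M)"
      unfolding set_lebesgue_integral_def K
      by (intro Bochner_Integration.integral_cong) (auto simp: indicator_def)
    finally show ?thesis by simp
  qed
  show ?thesis
    unfolding cprob_def[of M "\<F> (A \<union> C)"]
  proof (rule cond.real_cond_exp_charact)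
    fix K assume "K \<in> sets (\<F> (A \<union> C))"
    then have "K \<in> sigma_sets (space M) G" using gen by blast
    then show "(\<integral>\<omega>\<in>K. indicator E \<omega> \<partial>M) = (\<integral>\<omega>\<in>K. ?h \<omega> \<partial>M)"
      by (intro set_integral_eq_sigma_sets[OF _ _ G1 GM top eq]) auto
  next
    show "?h \<in> borel_measurable (\<F> (A \<union> C))"
      by (rule measurable_from_subalg[OF subalgebra_sigma_of_mono[of C] cprob_measurable]) simp
  qed auto
qed

text \<open>By the tower property \<open>g\<close> is automatically the conditional probability
  given \<open>\<F> C\<close>. The product formula comes from conditioning in two stages: on
  \<open>\<F> (A \<union> C)\<close>, where \<open>E1\<close> is known, then on
  \<open>\<F> C\<close>, where \<open>g\<close> is known.\<close>

lemma cindepI_measurable: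
  assumes "\<And>E. E \<in> sets (\<F> B) \<Longrightarrow>
    \<exists>g\<in>borel_measurable (\<F> C). AE \<omega> in M. cprob M (\<F> (A \<union> C)) E \<omega> = g \<omega>"
  shows "cindep M X A B C"
  unfolding cindep_def
proof (intro ballI)
  fix E1 E2 assume E1: "E1 \<in> sets (\<F> A)" and E2: "E2 \<in> sets (\<F> B)"
  let ?c = "cprob M (\<F> (A \<union> C)) E2"
  obtain g where g [measurable]: "g \<in> borel_measurable (\<F> C)" and cg: "AE \<omega> in M. ?c \<omega> = g \<omega>"
    using assms[OF E2] by blast
  have [measurable]: "E1 \<in> events" "E2 \<in> events" "E1 \<in> sets (\<F> (A \<union> C))"
    using E1 E2 sets_sigma_of_le sigma_of_mono[of A "A \<union> C"] by blast+
  have gM [measurable]: "g \<in> borel_measurable M"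
    by (rule measurable_from_subalg[OF subalgebra_sigma_of g])
  have gint: "integrable M g"
    using integrable_cong_AE[OF _ gM cg] by simp
  have sub: "subalgebra (\<F> (A \<union> C)) (\<F> C)" by (rule subalgebra_sigma_of_mono) simp
  have "AE \<omega> in M. real_cond_exp M (\<F> C) ?c \<omega> = cprob M (\<F> C) E2 \<omega>"
    unfolding cprob_def by (rule cond.real_cond_exp_nested_subalg[OF subalgebra_sigma_of sub]) simp
  moreover have "AE \<omega> in M. real_cond_exp M (\<F> C) ?c \<omega> = real_cond_exp M (\<F> C) g \<omega>"
    by (rule cond.real_cond_exp_cong[OF cg]) auto
  moreover have "AE \<omega> in M. real_cond_exp M (\<F> C) g \<omega> = g \<omega>"
    by (rule cond.real_cond_exp_F_meas[OF gint g])
  ultimately have e2: "AE \<omega> in M. cprob M (\<F> C) E2 \<omega> = g \<omega>" by eventually_elim simp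
  let ?I = "\<lambda>\<omega>. indicator E1 \<omega> * indicator E2 \<omega> :: real"
  have I: "integrable M ?I"
    using integrable_mult_indicator[of E1 M "indicator E2 :: 'a \<Rightarrow> real"] by simp
  have "AE \<omega> in M. real_cond_exp M (\<F> C) (real_cond_exp M (\<F> (A \<union> C)) ?I) \<omega>
      = real_cond_exp M (\<F> C) ?I \<omega>"
    by (rule cond.real_cond_exp_nested_subalg[OF subalgebra_sigma_of sub I])
  moreover have "AE \<omega> in M. real_cond_exp M (\<F> (A \<union> C)) ?I \<omega> = indicator E1 \<omega> * ?c \<omega>"
    unfolding cprob_def using I by (intro cond.real_cond_exp_mult) auto
  with cg have "AE \<omega> in M. real_cond_exp M (\<F> (A \<union> C)) ?I \<omega> = g \<omega> * indicator E1 \<omega>"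
    by eventually_elim simp
  then have "AE \<omega> in M. real_cond_exp M (\<F> C) (real_cond_exp M (\<F> (A \<union> C)) ?I) \<omega>
      = real_cond_exp M (\<F> C) (\<lambda>\<omega>. g \<omega> * indicator E1 \<omega>) \<omega>"
    by (rule cond.real_cond_exp_cong) auto
  moreover have "AE \<omega> in M. real_cond_exp M (\<F> C) (\<lambda>\<omega>. g \<omega> * indicator E1 \<omega>) \<omega>
      = g \<omega> * cprob M (\<F> C) E1 \<omega>"
    unfolding cprob_def using integrable_mult_indicator[OF _ gint, of E1]
    by (intro cond.real_cond_exp_mult) (auto simp: mult.commute)
  moreover have "?I = indicator (E1 \<inter> E2)" by (simp add: fun_eq_iff indicator_inter_arith)
  ultimately show "AE \<omega> in M. cprob M (\<F> C) E1 \<omega> * cprob M (\<F> C) E2 \<omega>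
      = cprob M (\<F> C) (E1 \<inter> E2) \<omega>"
    using e2 unfolding cprob_def[of M "\<F> C" "E1 \<inter> E2"]
    by (auto elim!: eventually_elim2)
qed

text \<open>The events on the right depend on \<open>A\<close> and \<open>C\<close> only through
  \<open>A \<union> C\<close>. Independence hypotheses with the same \<open>B\<close> and the same
  union therefore speak about the same events, and their information can be combined.\<close>

lemma cindep_iff_ess_measurable:
  "cindep M X A B C \<longleftrightarrow>
   (\<forall>E\<in>sets (\<F> B). \<forall>q. ess_measurable C {\<omega> \<in> space M. cprob M (\<F> (A \<union> C)) E \<omega> > q})"
proof safe
  fix E q assume "cindep M X A B C" "E \<in> sets (\<F> B)"
  then have "AE \<omega> in M. cprob M (\<F> (A \<union> C)) E \<omega> = cprob M (\<F> C) E \<omega>"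
    by (rule cindep_cprob_eq)
  then have "AE \<omega> in M. \<omega> \<in> {\<omega> \<in> space M. cprob M (\<F> (A \<union> C)) E \<omega> > q} \<longleftrightarrow>
      \<omega> \<in> {\<omega> \<in> space (\<F> C). cprob M (\<F> C) E \<omega> > q}"
    by eventually_elim simp
  moreover have "{\<omega> \<in> space (\<F> C). cprob M (\<F> C) E \<omega> > q} \<in> sets (\<F> C)" by measurable
  ultimately show "ess_measurable C {\<omega> \<in> space M. cprob M (\<F> (A \<union> C)) E \<omega> > q}"
    unfolding ess_measurable_def by blast
next
  assume ess: "\<forall>E\<in>sets (\<F> B). \<forall>q. ess_measurable C {\<omega> \<in> space M. cprob M (\<F> (A \<union> C)) E \<omega> > q}"
  show "cindep M X A B C"
  proof (rule cindepI_measurable, rule borel_measurable_AE_from_superlevel_sets)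
    fix E and q :: rat assume "E \<in> sets (\<F> B)"
    then obtain E' where E': "E' \<in> sets (\<F> C)" "AE \<omega> in M.
        \<omega> \<in> {\<omega> \<in> space M. cprob M (\<F> (A \<union> C)) E \<omega> > of_rat q} \<longleftrightarrow> \<omega> \<in> E'"
      using ess unfolding ess_measurable_def by blast
    from E'(2) AE_space have "AE \<omega> in M. of_rat q < cprob M (\<F> (A \<union> C)) E \<omega> \<longleftrightarrow> \<omega> \<in> E'"
      by eventually_elim simp
    with E'(1) show "\<exists>E'\<in>sets (\<F> C). AE \<omega> in M. of_rat q < cprob M (\<F> (A \<union> C)) E \<omega> \<longleftrightarrow> \<omega> \<in> E'"
      by blast
  qed (rule subalgebra_sigma_of)
qed

section \<open>The decorrelation property\<close>

text \<open>Finitely many further variables add nothing to what the \<open>D\<close>-variables tell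
  about a tail event \<open>E\<close>. Hence neither does the whole process, which determines
  \<open>E\<close>, so that \<open>?h\<close> is the indicator of \<open>E\<close> almost
  surely.\<close>

lemma DCP_if_decorrelated:
  assumes "\<And>B m. \<exists>V.
      (\<forall>A \<in> sets (\<F> UNIV). cvar_version M X B (cprob M (\<F> ({..m} \<union> B)) A) (V A)) \<and>
      (AE x in distr M (path_space B) (subfamily X B).
         \<exists>g :: nat \<Rightarrow> real. g \<longlonglongrightarrow> 0 \<and> (\<forall>n. \<forall>A \<in> sets (\<F> (B \<union> {n..})). V A x < g n))"
  shows "DCP M X"
  unfolding DCP_def
proof (intro allI ballI)
  fix D E assume E: "E \<in> (\<Inter>n. sets (\<F> (D \<union> {n..})))"
  have EU: "E \<in> sets (\<F> UNIV)" using E sigma_of_mono[of "D \<union> {0..}" UNIV] by blast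
  have EM [measurable]: "E \<in> events" using EU sets_sigma_of_le by blast
  let ?h = "cprob M (\<F> D) E"
  have eq_m: "AE \<omega> in M. cprob M (\<F> ({..m} \<union> D)) E \<omega> = ?h \<omega>" for m
  proof -
    let ?Y = "cprob M (\<F> ({..m} \<union> D)) E"
    let ?Z = "real_cond_exp M (\<F> D) ?Y"
    obtain V where V: "cvar_version M X D ?Y (V E)"
      "AE x in distr M (path_space D) (subfamily X D).
         \<exists>g :: nat \<Rightarrow> real. g \<longlonglongrightarrow> 0 \<and> (\<forall>n. \<forall>A \<in> sets (\<F> (D \<union> {n..})). V A x < g n)"
      using assms[of D m] EU by blast
    have sf: "subfamily X D \<in> measurable M (path_space D)"
      by (rule measurable_subfamily) (rule X_measurable)
    have YZ: "AE \<omega> in M. ?Z \<omega> = ?h \<omega>"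
      unfolding cprob_def
      by (rule cond.real_cond_exp_nested_subalg[OF subalgebra_sigma_of subalgebra_sigma_of_mono]) auto
    \<comment> \<open>The exceptional null set is fixed before \<open>n\<close> and
      \<open>A\<close>, so at almost every value the bound can be used with \<open>A = E\<close> for
      all \<open>n\<close> at once.\<close>
    have "AE \<omega> in M. V E (subfamily X D \<omega>) \<le> 0"
      using AE_distrD[OF sf V(2)]
    proof eventually_elim
      case (elim \<omega>)
      then obtain g :: "nat \<Rightarrow> real" where g: "g \<longlonglongrightarrow> 0" "\<And>n. V E (subfamily X D \<omega>) < g n"
        using E by blast
      show ?case by (rule LIMSEQ_le_const[OF g(1)]) (auto intro: less_imp_le g(2))
    qed
    moreover have "AE \<omega> in M. V E (subfamily X D \<omega>) = cvar M (\<F> D) ?Y \<omega>"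
      using V(1) unfolding cvar_version_def by blast
    ultimately have le: "AE \<omega> in M. cvar M (\<F> D) ?Y \<omega> \<le> 0"
      by eventually_elim simp
    let ?S = "\<lambda>\<omega>. (?Y \<omega> - ?Z \<omega>)\<^sup>2"
    \<comment> \<open>Two conditional probabilities differ by at most 1 almost surely. Integrability
      allows the integral of the conditional variance to be replaced by that of
      \<open>?S\<close>.\<close>
    have S: "integrable M ?S"
    proof (rule integrable_const_bound)
      show "AE \<omega> in M. norm (?S \<omega>) \<le> 1"
        using AE_cprob_bounds[OF EM, of "{..m} \<union> D"] AE_cprob_bounds[OF EM, of D] YZ
      proof eventually_elim
        case (elim \<omega>)
        then have "\<bar>?Y \<omega> - ?Z \<omega>\<bar> \<le> 1" by auto
        then show ?case by (simp add: abs_square_le_1)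
      qed
    qed measurable
    have "(\<integral>\<omega>. ?S \<omega> \<partial>M) = (\<integral>\<omega>. cvar M (\<F> D) ?Y \<omega> \<partial>M)"
      unfolding cvar_def using cond.real_cond_exp_int(2)[OF S] by simp
    also have "\<dots> \<le> 0"
      using integral_mono_AE[OF _ _ le] cond.real_cond_exp_int(1)[OF S] by (simp add: cvar_def)
    finally have "(\<integral>\<omega>. ?S \<omega> \<partial>M) = 0"
      by (intro antisym) auto
    then have "AE \<omega> in M. ?S \<omega> = 0"
      by (subst (asm) integral_nonneg_eq_0_iff_AE[OF S]) auto
    with YZ show ?thesis by eventually_elim simp
  qed
  \<comment> \<open>This increasing union is a pi-system generating \<open>\<F> UNIV\<close>;
    comparing integrals over it takes the place of martingale convergence in
    \<open>m\<close>.\<close>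
  define G where "G = (\<Union>m. sets (\<F> ({..m} \<union> D)))"
  have mono: "sets (\<F> ({..m} \<union> D)) \<subseteq> sets (\<F> ({..k} \<union> D))" if "m \<le> k" for m k
    using that by (intro sigma_of_mono) auto
  have GM: "G \<subseteq> events" unfolding G_def using sets_sigma_of_le by blast
  have G1: "Int_stable G"
  proof (rule Int_stableI)
    fix a b assume "a \<in> G" "b \<in> G"
    then obtain m k where "a \<in> sets (\<F> ({..m} \<union> D))" "b \<in> sets (\<F> ({..k} \<union> D))"
      unfolding G_def by blast
    then have "a \<inter> b \<in> sets (\<F> ({..max m k} \<union> D))"
      using mono[of m "max m k"] mono[of k "max m k"] by (intro sets.Int) auto
    then show "a \<inter> b \<in> G" unfolding G_def by blast
  qed
  have top: "space M \<in> G" unfolding G_def using sets.top[of "\<F> ({..0} \<union> D)"] by (intro UN_I[of 0]) auto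
  have gen: "sets (\<F> UNIV) \<subseteq> sigma_sets (space M) G"
  proof (rule sets_sigma_of_subset_sigma_sets)
    show "G \<subseteq> Pow (space M)" using GM sets.sets_into_space by blast
    show "\<exists>T. i \<in> T \<and> sets (\<F> T) \<subseteq> G" for i
      unfolding G_def by (intro exI[of _ "{..i} \<union> D"] conjI UN_upper) simp_all
  qed
  have eq: "(\<integral>\<omega>\<in>K. indicator E \<omega> \<partial>M) = (\<integral>\<omega>\<in>K. ?h \<omega> \<partial>M)" if KG: "K \<in> G" for K
  proof -
    obtain m where K: "K \<in> sets (\<F> ({..m} \<union> D))" using KG unfolding G_def by blast
    have KM [measurable]: "K \<in> events" using K sets_sigma_of_le by blast
    have "(\<integral>\<omega>\<in>K. indicator E \<omega> \<partial>M) = (\<integral>\<omega>\<in>K. cprob M (\<F> ({..m} \<union> D)) E \<omega> \<partial>M)"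
      unfolding cprob_def using K by (intro cond.real_cond_exp_intA) auto
    also have "\<dots> = (\<integral>\<omega>\<in>K. ?h \<omega> \<partial>M)"
      using eq_m[of m] by (intro set_lebesgue_integral_cong_AE) auto
    finally show ?thesis .
  qed
  have "AE \<omega> in M. real_cond_exp M (\<F> UNIV) (indicator E) \<omega> = ?h \<omega>"
  proof (rule cond.real_cond_exp_charact)
    fix K assume "K \<in> sets (\<F> UNIV)"
    then have "K \<in> sigma_sets (space M) G" using gen by blast
    then show "(\<integral>\<omega>\<in>K. indicator E \<omega> \<partial>M) = (\<integral>\<omega>\<in>K. ?h \<omega> \<partial>M)"
      by (intro set_integral_eq_sigma_sets[OF _ _ G1 GM top eq]) auto
  next
    show "?h \<in> borel_measurable (\<F> UNIV)"
      by (rule measurable_from_subalg[OF subalgebra_sigma_of_mono[of D] cprob_measurable]) simp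
  qed auto
  moreover have "AE \<omega> in M. real_cond_exp M (\<F> UNIV) (indicator E) \<omega> = indicator E \<omega>"
    using EU by (intro cond.real_cond_exp_F_meas) auto
  ultimately have h: "AE \<omega> in M. ?h \<omega> = indicator E \<omega>" by eventually_elim simp
  define E' where "E' = {\<omega> \<in> space (\<F> D). ?h \<omega> > 1 / 2}"
  have E': "E' \<in> sets (\<F> D)" unfolding E'_def by measurable
  then have [measurable]: "E' \<in> events" using sets_sigma_of_le by blast
  have "AE \<omega> in M. \<omega> \<notin> (E - E') \<union> (E' - E)"
    using h AE_space by eventually_elim (auto simp: E'_def indicator_def split: if_splits)
  then have "prob ((E - E') \<union> (E' - E)) = 0"
    by (subst prob_eq_0) auto
  with E' show "\<exists>E'\<in>sets (\<F> D). prob ((E - E') \<union> (E' - E)) = 0" by blast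
qed

text \<open>The events representing \<open>L\<close> vary with \<open>n\<close>, and a single one
  need not lie in all the algebras. Their limit superior does, and it agrees with \<open>L\<close>
  off a countable union of null sets, so \<open>DCP\<close> applies to it.\<close>

lemma ess_measurable_Inter_tail:
  assumes DCP: "DCP M X" and ess: "\<And>n. ess_measurable (Z \<union> {n..}) L"
  shows "ess_measurable Z L"
proof -
  obtain E where E: "E n \<in> sets (\<F> (Z \<union> {n..}))" "AE \<omega> in M. \<omega> \<in> L \<longleftrightarrow> \<omega> \<in> E n" for n
    using ess unfolding ess_measurable_def by metis
  define T where "T = (\<Inter>n. \<Union>k\<in>{n..}. E k)"
  have "T \<in> sets (\<F> (Z \<union> {m..}))" for m
  proof -
    \<comment> \<open>The unions decrease in \<open>n\<close>, so starting at \<open>max m n\<close>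
      changes nothing and leaves only events \<open>E k\<close> with
      \<open>k \<ge> m\<close>.\<close>
    have "T = (\<Inter>n. \<Union>k\<in>{max m n..}. E k)"
      unfolding T_def
    proof (intro equalityI subsetI INT_I)
      fix \<omega> n assume "\<omega> \<in> (\<Inter>n. \<Union>k\<in>{n..}. E k)"
      then show "\<omega> \<in> (\<Union>k\<in>{max m n..}. E k)" by blast
    next
      fix \<omega> n assume "\<omega> \<in> (\<Inter>n. \<Union>k\<in>{max m n..}. E k)"
      then obtain k where "k \<ge> max m n" "\<omega> \<in> E k" by blast
      then show "\<omega> \<in> (\<Union>k\<in>{n..}. E k)" by auto
    qed
    moreover have "E k \<in> sets (\<F> (Z \<union> {m..}))" if "k \<ge> m" for k
    proof -
      have "Z \<union> {k..} \<subseteq> Z \<union> {m..}" using that by auto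
      then show ?thesis using E(1)[of k] sigma_of_mono by blast
    qed
    then have "(\<Inter>n. \<Union>k\<in>{max m n..}. E k) \<in> sets (\<F> (Z \<union> {m..}))"
      by (intro sets.countable_INT' sets.countable_UN'') auto
    ultimately show ?thesis by simp
  qed
  then obtain E' where E': "E' \<in> sets (\<F> Z)" "prob ((T - E') \<union> (E' - T)) = 0"
    using DCP unfolding DCP_def by blast
  have [measurable]: "T \<in> events" "E' \<in> events"
    using \<open>T \<in> sets (\<F> (Z \<union> {0..}))\<close> E'(1) sets_sigma_of_le by blast+
  have "AE \<omega> in M. \<omega> \<notin> (T - E') \<union> (E' - T)"
    using E'(2) by (subst (asm) prob_eq_0) auto
  moreover have "AE \<omega> in M. \<forall>n. \<omega> \<in> L \<longleftrightarrow> \<omega> \<in> E n"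
    using E(2) by (simp add: AE_all_countable)
  ultimately have "AE \<omega> in M. \<omega> \<in> L \<longleftrightarrow> \<omega> \<in> E'"
    by eventually_elim (auto simp: T_def)
  with E'(1) show ?thesis unfolding ess_measurable_def by blast
qed

end

section \<open>Positivity and the two intersection properties\<close>

locale nondegenerate_process = binary_process +
  assumes nondegenerate: "\<And>I. finite I \<Longrightarrow>
      \<exists>c>0. \<forall>J a b. finite J \<and> I \<inter> J = {} \<and> a \<in> I \<rightarrow> {0, 1} \<and> b \<in> J \<rightarrow> {0, 1} \<and>
        measure M {\<omega> \<in> space M. \<forall>j\<in>J. X j \<omega> = b j} > 0
        \<longrightarrow> cond_prob M (\<lambda>\<omega>. \<forall>i\<in>I. X i \<omega> = a i) (\<lambda>\<omega>. \<forall>j\<in>J. X j \<omega> = b j) > c"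
begin

text \<open>Positivity with all values 0 on \<open>I\<close> bounds the probability of the second
  event, given an event of the \<open>T\<close>-variables, below by some \<open>c > 0\<close>. Hence
  \<open>c * prob E \<le> 0\<close>.\<close>

lemma prob_0_if_prob_inter_0:
  assumes I: "finite I" "I \<inter> T = {}" and E: "E \<in> sets (\<F> T)"
    and 0: "prob (E \<inter> {\<omega> \<in> space M. \<forall>i\<in>I. X i \<omega> = 0}) = 0"
  shows "prob E = 0"
proof -
  obtain c where c: "c > 0" "\<forall>J a b. finite J \<and> I \<inter> J = {} \<and> a \<in> I \<rightarrow> {0, 1} \<and> b \<in> J \<rightarrow> {0, 1} \<and>
        prob {\<omega> \<in> space M. \<forall>j\<in>J. X j \<omega> = b j} > 0 \<longrightarrow>
        cond_prob M (\<lambda>\<omega>. \<forall>i\<in>I. X i \<omega> = a i) (\<lambda>\<omega>. \<forall>j\<in>J. X j \<omega> = b j) > c"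
    using nondegenerate[OF I(1)] by (elim exE conjE)
  have "c * prob E \<le> prob (E \<inter> {\<omega> \<in> space M. \<forall>i\<in>I. X i \<omega> = 0})"
  proof (rule prob_inter_ge[OF _ c(1) _ E])
    show "{\<omega> \<in> space M. \<forall>i\<in>I. X i \<omega> = 0} \<in> events" using I(1) by measurable
    fix J b assume J: "finite J" "J \<subseteq> T" and b: "b \<in> J \<rightarrow> {0, 1::nat}"
      "prob {\<omega> \<in> space M. \<forall>j\<in>J. X j \<omega> = b j} > 0"
    have "I \<inter> J = {}" using I(2) J(2) by blast
    with J(1) b show "c < cond_prob M (\<lambda>\<omega>. \<forall>i\<in>I. X i \<omega> = 0) (\<lambda>\<omega>. \<forall>j\<in>J. X j \<omega> = b j)"
      by (intro c(2)[rule_format, of J "\<lambda>_. 0" b] conjI) simp_all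
  qed
  then show ?thesis using 0 c(1) by (simp add: mult_le_0_iff measure_le_0_iff)
qed

lemma ess_measurable_Int:
  assumes S: "ess_measurable S L" and T: "ess_measurable T L" and fin: "finite (S - T)"
  shows "ess_measurable (S \<inter> T) L"
proof -
  obtain E1 where E1: "E1 \<in> sets (\<F> S)" "AE \<omega> in M. \<omega> \<in> L \<longleftrightarrow> \<omega> \<in> E1"
    using S unfolding ess_measurable_def by blast
  obtain E2 where E2: "E2 \<in> sets (\<F> T)" "AE \<omega> in M. \<omega> \<in> L \<longleftrightarrow> \<omega> \<in> E2"
    using T unfolding ess_measurable_def by blast
  obtain B where B: "B \<in> sets (path_space S)" "E1 = {\<omega> \<in> space M. subfamily X S \<omega> \<in> B}"
    using E1(1) sets_sigma_of_iff by blast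
  \<comment> \<open>\<open>x\<close> is \<open>X\<^sub>S\<close> with the coordinates outside \<open>T\<close> replaced by \<open>0\<close>\<close>
  define x where "x \<omega> = (\<lambda>i\<in>S. if i \<in> T then X i \<omega> else 0)" for \<omega>
  define E3 where "E3 = {\<omega> \<in> space M. x \<omega> \<in> B}"
  have "x \<in> measurable (\<F> (S \<inter> T)) (path_space S)"
    unfolding x_def path_space_def
  proof (rule measurable_restrict)
    fix i assume "i \<in> S"
    then show "(\<lambda>\<omega>. if i \<in> T then X i \<omega> else 0) \<in> measurable (\<F> (S \<inter> T)) (count_space {0, 1})"
      by (cases "i \<in> T") (auto intro: measurable_X[simplified])
  qed
  then have "x -` B \<inter> space (\<F> (S \<inter> T)) \<in> sets (\<F> (S \<inter> T))"
    using B(1) by (rule measurable_sets)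
  also have "x -` B \<inter> space (\<F> (S \<inter> T)) = E3" by (auto simp: E3_def)
  finally have E3: "E3 \<in> sets (\<F> (S \<inter> T))" .
  let ?D = "(E2 - E3) \<union> (E3 - E2)" and ?Q = "{\<omega> \<in> space M. \<forall>i\<in>S - T. X i \<omega> = 0}"
  \<comment> \<open>Both events in \<open>?D\<close> now avoid the coordinates in
    \<open>S - T\<close>, so positivity of \<open>?Q\<close> given the \<open>T\<close>-variables
    can be applied to \<open>?D\<close>.\<close>
  have E3T: "E3 \<in> sets (\<F> T)" using E3 sigma_of_mono[of "S \<inter> T" T] by blast
  then have D: "?D \<in> sets (\<F> T)" using E2(1) by auto
  have DM: "?D \<in> events" using D sets_sigma_of_le by blast
  have QM: "?Q \<in> events" using fin by measurable
  have xQ: "x \<omega> = subfamily X S \<omega>" if "\<forall>i\<in>S - T. X i \<omega> = 0" for \<omega>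
    using that by (auto simp: x_def subfamily_def)
  have "AE \<omega> in M. \<omega> \<notin> ?D \<inter> ?Q"
    using E1(2) E2(2)
  proof eventually_elim
    case (elim \<omega>)
    have "\<omega> \<in> E3 \<longleftrightarrow> \<omega> \<in> E1" if "\<omega> \<in> ?Q"
      using that xQ[of \<omega>] by (simp add: E3_def B(2))
    with elim show ?case by blast
  qed
  then have "prob (?D \<inter> ?Q) = 0" using DM QM by (subst prob_eq_0) auto
  then have "prob ?D = 0" by (intro prob_0_if_prob_inter_0[OF fin _ D]) auto
  then have "AE \<omega> in M. \<omega> \<notin> ?D" using DM by (subst (asm) prob_eq_0) auto
  with E2(2) have "AE \<omega> in M. \<omega> \<in> L \<longleftrightarrow> \<omega> \<in> E3" by eventually_elim auto
  with E3 show ?thesis unfolding ess_measurable_def by blast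
qed

text \<open>With the arguments of \<open>cindep\<close> swapped, both hypotheses concern the same
  event \<open>?L\<close>, as both unions are \<open>B \<union> C \<union> D\<close>. The two
  conditioning sets meet exactly in \<open>D\<close>.\<close>

lemma IIP: "IIP M X"
  unfolding IIP_def
proof (intro allI impI, elim conjE)
  fix D A B C :: "nat set"
  assume fin: "finite B" and disj: "B \<inter> C = {}"
    and AB: "cindep M X A B (C \<union> D)" and AC: "cindep M X A C (B \<union> D)"
  have "cindep M X (B \<union> C) A D"
    unfolding cindep_iff_ess_measurable
  proof (intro ballI allI)
    fix E q assume E: "E \<in> sets (\<F> A)"
    let ?L = "{\<omega> \<in> space M. cprob M (\<F> (B \<union> C \<union> D)) E \<omega> > q}"
    have 1: "ess_measurable (C \<union> D) ?L"
      using cindep_sym[OF AB] E unfolding cindep_iff_ess_measurable by (simp add: Un_assoc)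
    have 2: "ess_measurable (B \<union> D) ?L"
      using cindep_sym[OF AC] E unfolding cindep_iff_ess_measurable
      by (simp add: Un_left_commute[of C] Un_assoc)
    have "ess_measurable ((B \<union> D) \<inter> (C \<union> D)) ?L"
      by (rule ess_measurable_Int[OF 2 1]) (use fin in \<open>auto intro: finite_subset[of _ B]\<close>)
    moreover have "(B \<union> D) \<inter> (C \<union> D) = D" using disj by blast
    ultimately show "ess_measurable D ?L" by simp
  qed
  then show "cindep M X A (B \<union> C) D" by (rule cindep_sym)
qed

text \<open>Each part and its conditioning set together make up \<open>U \<union> Z\<close>, so
  every hypothesis speaks of the same event \<open>?L\<close>. Removing finitely many parts suffices
  to describe \<open>?L\<close> by \<open>Z\<close> and the indices from \<open>n\<close> on, for
  any given \<open>n\<close>.\<close>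

lemma P5star_if_DCP:
  assumes DCP: "DCP M X"
  shows "P5star M X"
  unfolding P5star_def
proof (intro allI impI, elim conjE)
  fix U Y Z :: "nat set" and P
  assume P: "partition_on U P" and fin: "\<forall>K\<in>P. finite K"
    and ind: "\<forall>K\<in>P. cindep M X K Y (Z \<union> \<Union>(P - {K}))"
  have UP: "\<Union>P = U" using P by (simp add: partition_on_def)
  have disj: "K \<inter> K' = {}" if "K \<in> P" "K' \<in> P" "K \<noteq> K'" for K K'
    using P that by (auto simp: partition_on_def dest: disjointD)
  show "cindep M X U Y Z"
    unfolding cindep_iff_ess_measurable
  proof (intro ballI allI)
    fix E q assume E: "E \<in> sets (\<F> Y)"
    let ?L = "{\<omega> \<in> space M. cprob M (\<F> (U \<union> Z)) E \<omega> > q}"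
    have one: "ess_measurable (Z \<union> \<Union>(P - {K})) ?L" if K: "K \<in> P" for K
    proof -
      have "K \<union> (Z \<union> \<Union>(P - {K})) = U \<union> Z" using K UP by blast
      moreover have "cindep M X K Y (Z \<union> \<Union>(P - {K}))" using ind K by blast
      ultimately show ?thesis using E unfolding cindep_iff_ess_measurable by simp
    qed
    have many: "ess_measurable (Z \<union> \<Union>(P - Q)) ?L" if "finite Q" "Q \<subseteq> P" for Q
      using that
    proof (induction rule: finite_induct)
      case empty
      have "?L = {\<omega> \<in> space (\<F> (U \<union> Z)). cprob M (\<F> (U \<union> Z)) E \<omega> > q}" by simp
      also have "\<dots> \<in> sets (\<F> (U \<union> Z))" by measurable
      finally have "ess_measurable (U \<union> Z) ?L"
        unfolding ess_measurable_def by (intro bexI[of _ ?L]) auto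
      then show ?case using UP by (simp add: Un_commute)
    next
      case (insert K Q)
      have K: "K \<in> P" using insert.prems by blast
      let ?S = "Z \<union> \<Union>(P - Q)" and ?T = "Z \<union> \<Union>(P - {K})"
      have "?S - ?T \<subseteq> K" by blast
      then have "finite (?S - ?T)" using fin K finite_subset by blast
      then have "ess_measurable (?S \<inter> ?T) ?L"
        using insert K by (intro ess_measurable_Int one) auto
      \<comment> \<open>Parts may meet \<open>Z\<close>, so its indices are set apart. Any other
        index in both sets lies in a single part, which is neither in \<open>Q\<close> nor equal to
        \<open>K\<close>.\<close>
      moreover have "?S \<inter> ?T \<subseteq> Z \<union> \<Union>(P - insert K Q)"
      proof
        fix i assume i: "i \<in> ?S \<inter> ?T"
        show "i \<in> Z \<union> \<Union>(P - insert K Q)"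
        proof (cases "i \<in> Z")
          case False
          then obtain K1 K2 where "K1 \<in> P - Q" "i \<in> K1" "K2 \<in> P - {K}" "i \<in> K2"
            using i by blast
          moreover from this have "K1 = K2" using disj[of K1 K2] by blast
          ultimately show ?thesis by blast
        qed simp
      qed
      ultimately show ?case by (rule ess_measurable_mono)
    qed
    show "ess_measurable Z ?L"
    proof (rule ess_measurable_Inter_tail[OF DCP])
      fix n
      \<comment> \<open>Disjoint parts have distinct nonempty traces on \<open>{..<n}\<close>, so
        only finitely many parts reach below \<open>n\<close>.\<close>
      let ?Q = "{K \<in> P. K \<inter> {..<n} \<noteq> {}}"
      have "inj_on (\<lambda>K. K \<inter> {..<n}) ?Q"
      proof (rule inj_onI)
        fix K K' assume K: "K \<in> ?Q" "K' \<in> ?Q" "K \<inter> {..<n} = K' \<inter> {..<n}"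
        then have "K \<inter> K' \<noteq> {}" by blast
        then show "K = K'" using disj[of K K'] K by blast
      qed
      moreover have "(\<lambda>K. K \<inter> {..<n}) ` ?Q \<subseteq> Pow {..<n}" by blast
      ultimately have "finite ?Q" by (rule inj_on_finite) simp
      then have "ess_measurable (Z \<union> \<Union>(P - ?Q)) ?L" by (rule many) blast
      moreover have "Z \<union> \<Union>(P - ?Q) \<subseteq> Z \<union> {n..}" by force
      ultimately show "ess_measurable (Z \<union> {n..}) ?L" by (rule ess_measurable_mono)
    qed
  qed
qed

end

theorem theorem2p8:
  fixes M :: "'a measure" and X :: "nat \<Rightarrow> 'a \<Rightarrow> nat"
  assumes "prob_space M"
    and "\<And>n. X n \<in> measurable M (count_space {0, 1})"
    and "\<And>I. finite I \<Longrightarrow>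
      \<exists>c>0. \<forall>J a b. finite J \<and> I \<inter> J = {} \<and> a \<in> I \<rightarrow> {0, 1} \<and> b \<in> J \<rightarrow> {0, 1} \<and>
        measure M {\<omega> \<in> space M. \<forall>j\<in>J. X j \<omega> = b j} > 0
        \<longrightarrow> cond_prob M (\<lambda>\<omega>. \<forall>i\<in>I. X i \<omega> = a i) (\<lambda>\<omega>. \<forall>j\<in>J. X j \<omega> = b j) > c"
    and "\<And>B m. \<exists>V.
      (\<forall>A \<in> sets (sigma_of M X UNIV).
         cvar_version M X B (cprob M (sigma_of M X ({..m} \<union> B)) A) (V A)) \<and>
      (AE x in distr M (path_space B) (subfamily X B).
         \<exists>g :: nat \<Rightarrow> real. g \<longlonglongrightarrow> 0 \<and>
           (\<forall>n. \<forall>A \<in> sets (sigma_of M X (B \<union> {n..})). V A x < g n))"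
  shows "IIP M X \<and> DCP M X \<and> P5star M X"
proof -
  interpret nondegenerate_process M X
    by (intro nondegenerate_process.intro binary_process.intro binary_process_axioms.intro
        nondegenerate_process_axioms.intro assms(1-3))
  have "DCP M X" by (rule DCP_if_decorrelated[OF assms(4)])
  then show ?thesis using IIP P5star_if_DCP by blast
qed

end
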